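(* For any string $S$ over the binary alphabet $\Sigma_2 = \{\mathtt{0},\mathtt{1}\}$ with $|S| = d \ge 3$, $$|\mathsf{MAW}(S) \bigtriangleup \mathsf{MAW}(S\mathtt{0})| \le d,$$ and this upper bound is tight: for every $d \ge 3$ there is a string $S$ over $\Sigma_2$ with $|S| = d$ and $|\mathsf{MAW}(S) \bigtriangleup \mathsf{MAW}(S\mathtt{0})| = d$.
   Context: A string $w$ occurs in $S$ if it is a (contiguous) substring of $S$; the empty string occurs in every string. A non-empty string $w \in \Sigma_2^*$ is a minimal absent word (MAW) for $S$ if $w$ does not occur in $S$ but every proper substring of $w$ occurs in $S$ (in particular a character of $\Sigma_2$ not occurring in $S$ is a MAW for $S$). $\mathsf{MAW}(S)$ is the set of all MAWs for $S$ relative to the alphabet $\Sigma_2$. $\bigtriangleup$ denotes symmetric difference, and $S\mathtt{0}$ is $S$ with the character $\mathtt{0}$ appended on the right. *)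

theory Defs
  imports "HOL-Library.Sublist"
begin

datatype bin = Zero (\<open>\<zero>\<close>) | One (\<open>\<one>\<close>)

text \<open>
  A word \<open>w\<close> occurs in \<open>S\<close> iff \<^prop>\<open>sublist w S\<close> (a contiguous block); the proper
  substrings of \<open>w\<close>, including the empty one, are the \<open>v\<close> with \<^prop>\<open>strict_sublist v w\<close>.
  The alphabet is the whole type \<^typ>\<open>bin\<close>, so a character not occurring in \<open>S\<close> is a
  minimal absent word of length one.
\<close>

definition minimal_absent_word :: "bin list \<Rightarrow> bin list \<Rightarrow> bool" where
  "minimal_absent_word S w \<longleftrightarrow>
     w \<noteq> [] \<and> \<not> sublist w S \<and> (\<forall>v. strict_sublist v w \<longrightarrow> sublist v S)"

definition MAW :: "bin list \<Rightarrow> bin list set" where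
  "MAW S = {w. minimal_absent_word S w}"

text \<open>
  \<^term>\<open>MAW S\<close> is finite, so cardinalities of sets formed from it are not the default
  value \<open>0\<close> that \<^const>\<open>card\<close> takes on infinite sets.
\<close>

lemma finite_MAW: "finite (MAW S)"
proof (rule finite_subset)
  show "MAW S \<subseteq> {w. set w \<subseteq> {\<zero>, \<one>} \<and> length w \<le> Suc (length S)}"
  proof
    fix w assume w: "w \<in> MAW S"
    then have "w \<noteq> []" by (simp add: MAW_def minimal_absent_word_def)
    then have "strict_sublist (tl w) w"
      by (cases w) (auto simp: strict_sublist_def sublist_Cons_right)
    with w have "sublist (tl w) S" by (simp add: MAW_def minimal_absent_word_def)
    then have "length (tl w) \<le> length S" by (rule sublist_length_le)
    moreover have "set w \<subseteq> {\<zero>, \<one>}" by (auto intro: bin.exhaust)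
    ultimately show "w \<in> {w. set w \<subseteq> {\<zero>, \<one>} \<and> length w \<le> Suc (length S)}" by auto
  qed
  show "finite {w. set w \<subseteq> {\<zero>, \<one>} \<and> length w \<le> Suc (length S)}"
    by (rule finite_lists_length_le) simp
qed

end

theory Submission
  imports Defs
begin

text \<open>
  A word that is absent from \<open>S\<close> but present in \<open>S\<zero>\<close> is a suffix of \<open>S\<zero>\<close>. Let \<open>t\<close> be the shortest
  suffix of \<open>S\<zero>\<close> absent from \<open>S\<close>. The only word that can leave the set is \<open>t\<close>. A new word \<open>w = aub\<close>
  has \<open>au\<close> or \<open>ub\<close> absent from \<open>S\<close>: if \<open>au\<close> is absent then \<open>au = t\<close>, which leaves two choices for
  \<open>b\<close>; otherwise \<open>ub\<close> is a suffix of \<open>S\<zero>\<close> of length between \<open>\<bar>t\<bar>\<close> and \<open>d - 1\<close>, and this length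
  determines \<open>a\<close>, the alphabet being binary. This gives at most \<open>3 + (d - \<bar>t\<bar>)\<close> changes, which is
  enough for \<open>\<bar>t\<bar> \<ge> 3\<close>. If \<open>\<bar>t\<bar> = 1\<close> then \<open>S = \<one>\<^sup>d\<close> and the second kind does not occur; if \<open>\<bar>t\<bar> = 2\<close>
  and the length \<open>d - 1\<close> is attained, then \<open>S = \<zero>\<one>\<^sup>d\<^sup>-\<^sup>1\<close>, where only one choice of \<open>b\<close> survives.
  That last word attains the bound.
\<close>

section \<open>Occurrences in an extended word and the test for minimality\<close>

lemma sublist_append_single_iff:
  "sublist w (S @ [c]) \<longleftrightarrow> sublist w S \<or> suffix w (S @ [c])"
proof -
  have "sublist w (S @ [c]) \<longleftrightarrow> sublist (rev w) (c # rev S)"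
    using sublist_rev[of w "S @ [c]"] by simp
  also have "\<dots> \<longleftrightarrow> prefix (rev w) (rev (S @ [c])) \<or> sublist (rev w) (rev S)"
    by (simp add: sublist_Cons_right)
  finally show ?thesis by (auto simp: suffix_to_prefix)
qed

text \<open>An occurrence of a proper factor leaves one of the end letters uncovered. Minimality can
  therefore be tested on the two maximal proper factors alone.\<close>

lemma strict_sublist_Cons_snoc_iff:
  "strict_sublist v (a # u @ [b]) \<longleftrightarrow> sublist v (a # u) \<or> sublist v (u @ [b])"
proof
  assume v: "strict_sublist v (a # u @ [b])"
  then obtain ps ss where e: "a # u @ [b] = ps @ v @ ss" and ne: "v \<noteq> a # u @ [b]"
    by (auto simp: strict_sublist_def sublist_def)
  show "sublist v (a # u) \<or> sublist v (u @ [b])"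
  proof (cases ps)
    case (Cons p ps')
    then have "u @ [b] = ps' @ v @ ss" using e by simp
    then show ?thesis by (metis sublist_appendI)
  next
    case Nil
    then have "ss \<noteq> []" using e ne by auto
    then have "a # u = v @ butlast ss" using e Nil
      by (metis append_Nil butlast_append butlast_snoc append_Cons)
    then show ?thesis by (metis sublist_append_rightI)
  qed
next
  assume "sublist v (a # u) \<or> sublist v (u @ [b])"
  moreover have "strict_sublist (a # u) (a # u @ [b])" "strict_sublist (u @ [b]) (a # u @ [b])"
    by (auto simp: strict_sublist_def sublist_Cons_right dest: arg_cong[where f = length])
  ultimately show "strict_sublist v (a # u @ [b])"
    using sublist_order.le_less_trans by blast
qed

lemma minimal_absent_word_Cons_snoc_iff:
  "minimal_absent_word S (a # u @ [b]) \<longleftrightarrow>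
     \<not> sublist (a # u @ [b]) S \<and> sublist (a # u) S \<and> sublist (u @ [b]) S"
  unfolding minimal_absent_word_def strict_sublist_Cons_snoc_iff
  by (metis append_is_Nil_conv list.distinct(1) sublist_order.order.refl sublist_order.order.trans)

lemma minimal_absent_word_singleton_iff:
  "minimal_absent_word S [c] \<longleftrightarrow> \<not> sublist [c] S"
  by (auto simp: minimal_absent_word_def strict_sublist_def sublist_Cons_right prefix_Cons)

lemma list_Nil_single_Cons_snoc_cases:
  obtains "w = []" | c where "w = [c]" | a u b where "w = a # u @ [b]"
  by (cases w; cases "tl w" rule: rev_cases) auto

lemma suffix_same_length_eq:
  assumes "suffix p s" "suffix q s" "length p = length q"
  shows "p = q"
  using assms by (auto simp: suffix_def)

lemma suffix_shorter:
  assumes "suffix p s" "suffix q s" "length p \<le> length q"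
  shows "suffix p q"
  using assms suffix_length_suffix by blast

lemma sublist_length_Suc_cases:
  assumes "sublist v S" "length S = Suc (length v)"
  shows "(\<exists>c. S = v @ [c]) \<or> (\<exists>c. S = c # v)"
proof -
  obtain ps ss where S: "S = ps @ v @ ss" using assms(1) by (auto simp: sublist_def)
  with assms(2) have "length ps + length ss = 1" by simp
  then have "(ps = [] \<and> length ss = 1) \<or> (length ps = 1 \<and> ss = [])"
    by (cases ps) auto
  then show ?thesis using S by (auto simp: length_Suc_conv)
qed

section \<open>The shortest new suffix\<close>

text \<open>Minimality is encoded by \<open>tl t\<close> alone: every shorter suffix of
  \<open>S @ [\<zero>]\<close> is a suffix of \<open>tl t\<close> and so occurs in \<open>S\<close>
  with it.\<close>

definition shortest_new_suffix :: "bin list \<Rightarrow> bin list \<Rightarrow> bool" where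
  "shortest_new_suffix S t \<longleftrightarrow>
     suffix t (S @ [\<zero>]) \<and> \<not> sublist t S \<and> sublist (tl t) S"

lemma shortest_new_suffix_le:
  assumes "shortest_new_suffix S t" "suffix p (S @ [\<zero>])" "\<not> sublist p S"
  shows "length t \<le> length p"
proof (rule ccontr)
  assume l: "\<not> length t \<le> length p"
  have "suffix (tl t) (S @ [\<zero>])"
    using assms(1) suffix_tl suffix_order.trans unfolding shortest_new_suffix_def by blast
  from suffix_shorter[OF assms(2) this] have "suffix p (tl t)" using l by simp
  then show False
    using assms(1,3) suffix_imp_sublist sublist_order.order.trans
    unfolding shortest_new_suffix_def by blast
qed

lemma shortest_new_suffix_unique:
  assumes "shortest_new_suffix S t" "shortest_new_suffix S p"
  shows "p = t"
  using assms shortest_new_suffix_le[of S t p] shortest_new_suffix_le[of S p t]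
    suffix_same_length_eq[of p "S @ [\<zero>]" t]
  by (simp add: shortest_new_suffix_def)

lemma shortest_new_suffix_exists: "\<exists>t. shortest_new_suffix S t"
proof -
  let ?P = "\<lambda>p. suffix p (S @ [\<zero>]) \<and> \<not> sublist p S"
  \<comment> \<open>The whole word is longer than \<open>S\<close>, so there is a candidate to
    minimise over.\<close>
  have "?P (S @ [\<zero>])" using sublist_length_le[of "S @ [\<zero>]" S] by auto
  then obtain t where t: "?P t" and min: "\<And>p. ?P p \<Longrightarrow> length t \<le> length p"
    using ex_has_least_nat[of ?P "S @ [\<zero>]" length] by blast
  have "t \<noteq> []" using t by auto
  have "suffix (tl t) (S @ [\<zero>])" using t suffix_tl suffix_order.trans by blast
  moreover have "length (tl t) < length t" using \<open>t \<noteq> []\<close> by simp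
  ultimately have "sublist (tl t) S" using min[of "tl t"] by auto
  then show ?thesis using t unfolding shortest_new_suffix_def by blast
qed

section \<open>Words leaving and entering the set\<close>

text \<open>Proper factors of \<open>w\<close> still occur after appending, so \<open>w\<close> can
  leave only by becoming a suffix of \<open>S @ [\<zero>]\<close>. Its tail occurs in
  \<open>S\<close> by minimality, and uniqueness gives \<open>w = t\<close>.\<close>

lemma MAW_removed_subset:
  assumes "shortest_new_suffix S t"
  shows "MAW S - MAW (S @ [\<zero>]) \<subseteq> {t}"
proof
  fix w assume w: "w \<in> MAW S - MAW (S @ [\<zero>])"
  then have m: "w \<noteq> []" "\<not> sublist w S" and sub: "\<And>v. strict_sublist v w \<Longrightarrow> sublist v S"
    by (auto simp: MAW_def minimal_absent_word_def)
  have "sublist w (S @ [\<zero>])"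
    using w m sub by (auto simp: MAW_def minimal_absent_word_def sublist_append_single_iff)
  then have "suffix w (S @ [\<zero>])" using m by (simp add: sublist_append_single_iff)
  moreover have "sublist (tl w) S"
    using m by (intro sub) (cases w; auto simp: strict_sublist_def sublist_Cons_right)
  ultimately show "w \<in> {t}"
    using m shortest_new_suffix_unique[OF assms] by (auto simp: shortest_new_suffix_def)
qed

text \<open>The alternatives are that the prefix \<open>a # u\<close> is new, or that only
  \<open>u @ [b]\<close> is. The occurrence of \<open>tl t @ [b]\<close> is recorded in order to
  discard one \<open>b\<close> in a boundary case of the count.\<close>

lemma MAW_added_cases:
  assumes "w \<in> MAW (S @ [\<zero>]) - MAW S" and t: "shortest_new_suffix S t"
  shows "(\<exists>b. w = t @ [b] \<and> sublist (tl t @ [b]) (S @ [\<zero>])) \<or>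
         (\<exists>a u. w = a # u @ [\<zero>] \<and> sublist (a # u) S \<and> \<not> sublist (u @ [\<zero>]) S \<and>
                suffix u S \<and> \<not> suffix (a # u) S)"
proof (cases w rule: list_Nil_single_Cons_snoc_cases)
  case 1
  then show ?thesis using assms(1) by (simp add: MAW_def minimal_absent_word_def)
next
  case (2 c)
  then show ?thesis
    using assms(1) by (auto simp: MAW_def minimal_absent_word_singleton_iff sublist_append_single_iff)
next
  case (3 a u b)
  have abs: "\<not> sublist (a # u @ [b]) (S @ [\<zero>])" and au: "sublist (a # u) (S @ [\<zero>])"
    and ub: "sublist (u @ [b]) (S @ [\<zero>])"
    and new: "\<not> (sublist (a # u) S \<and> sublist (u @ [b]) S)"
    using assms(1) by (auto simp: 3 MAW_def minimal_absent_word_Cons_snoc_iff sublist_append_single_iff)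
  show ?thesis
  proof (cases "sublist (a # u) S")
    case True
    then have nub: "\<not> sublist (u @ [b]) S" using new by simp
    then have "suffix (u @ [b]) (S @ [\<zero>])" using ub by (simp add: sublist_append_single_iff)
    then have b: "b = \<zero>" and u: "suffix u S" by auto
    have "\<not> suffix (a # u) S"
    proof
      assume "suffix (a # u) S"
      then have "suffix ((a # u) @ [\<zero>]) (S @ [\<zero>])" by (simp only: snoc_suffix_snoc)
      then show False using abs b by (auto dest: suffix_imp_sublist)
    qed
    then show ?thesis using 3 True nub b u by blast
  next
    case False
    then have "suffix (a # u) (S @ [\<zero>])" using au by (simp add: sublist_append_single_iff)
    \<comment> \<open>With \<open>u\<close> occurring in \<open>S\<close>, \<open>a # u\<close>
      meets the definition of the shortest new suffix.\<close>
    moreover have "sublist u S"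
    proof (cases "sublist (u @ [b]) S")
      case True
      then show ?thesis using sublist_append_rightI sublist_order.order.trans by blast
    next
      case False
      then have "suffix (u @ [b]) (S @ [\<zero>])" using ub by (simp add: sublist_append_single_iff)
      then show ?thesis by (auto dest: suffix_imp_sublist)
    qed
    ultimately have "a # u = t"
      using False shortest_new_suffix_unique[OF t] by (auto simp: shortest_new_suffix_def)
    then show ?thesis using 3 ub by auto
  qed
qed

section \<open>Left extensions over two letters\<close>

lemma bin_neq_imp_eq: "a \<noteq> c \<Longrightarrow> b \<noteq> c \<Longrightarrow> a = (b :: bin)"
  by (cases a; cases b; cases c) auto

lemma no_Zero_imp_replicate_One: "\<zero> \<notin> set w \<Longrightarrow> w = replicate (length w) \<one>"
  by (metis bin.exhaust replicate_eqI)

text \<open>Some letter \<open>c\<close> precedes the proper suffix \<open>u\<close> in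
  \<open>S\<close>; both \<open>a\<close> and \<open>b\<close> differ from \<open>c\<close>, and a
  binary alphabet has just one such letter.\<close>

lemma left_special_extension_unique:
  assumes "suffix u (S :: bin list)" "suffix v S" "length u = length v" "length u < length S"
    and "\<not> suffix (a # u) S" "\<not> suffix (b # v) S"
  shows "a = b \<and> u = v"
proof -
  have uv: "u = v" using assms(1-3) by (rule suffix_same_length_eq)
  obtain ps where S: "S = ps @ u" using assms(1) by (auto simp: suffix_def)
  then obtain qs c where "ps = qs @ [c]" using assms(4) by (cases ps rule: rev_cases) auto
  then have "suffix (c # u) S" using S by (simp add: suffix_def)
  then have "a \<noteq> c" "b \<noteq> c" using assms uv by auto
  then show ?thesis using uv bin_neq_imp_eq by blast
qed

lemma nonsuffix_length_less:
  assumes "sublist v S" "\<not> suffix v S"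
  shows "length v < length S"
proof -
  obtain ps ss where "S = ps @ v @ ss" using assms(1) by (auto simp: sublist_def)
  then show ?thesis using assms(2) by (cases ss) (auto simp: suffix_def)
qed

text \<open>Read letter by letter, the equation says that each letter of \<open>y # u\<close> equals
  its successor, and the last one equals \<open>c\<close>.\<close>

lemma suffix_shift_constant:
  assumes "u @ [c] = y # u"
  shows "u = replicate (length u) c \<and> y = c"
  using assms
proof (induction u arbitrary: y)
  case (Cons a u)
  then have "u = replicate (length u) c \<and> a = c" and "y = a" by simp_all
  then show ?case by (metis length_Cons replicate_Suc)
qed simp

text \<open>Being one letter shorter than \<open>S\<close> and no suffix, \<open>a # u\<close> is a
  prefix. As \<open>u\<close> is also a suffix, it overlaps itself with shift one and is
  constant.\<close>

lemma long_left_special_suffix: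
  assumes "sublist (a # u) S" "suffix u S" "\<not> suffix (a # u) S"
    and "length S = length u + 2"
  obtains c where "S = a # replicate (length u + 1) c" "a \<noteq> c"
proof -
  obtain c where c: "S = a # u @ [c]"
    using sublist_length_Suc_cases[OF assms(1)] assms(3,4) by (auto simp: suffix_def)
  obtain ps where ps: "S = ps @ u" using assms(2) by (auto simp: suffix_def)
  with assms(4) have "length ps = 2" by simp
  then obtain x y where "S = x # y # u" using ps by (auto simp: length_Suc_conv numeral_2_eq_2)
  then have "u @ [c] = y # u" using c by simp
  note y = conjunct1[OF suffix_shift_constant[OF this]] conjunct2[OF suffix_shift_constant[OF this]]
  have "S = a # replicate (length u + 1) c"
    using c y(1) by (metis replicate_append_same add.commute plus_1_eq_Suc replicate_Suc)
  moreover have "a \<noteq> c"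
    using \<open>S = x # y # u\<close> y(2) assms(3) by (auto simp: suffix_def)
  ultimately show ?thesis by (rule that)
qed

section \<open>The upper bound\<close>

text \<open>\<open>R\<close> holds the removed words, \<open>B\<close> the new words extending
  \<open>t\<close>, \<open>C\<close> those counted by length. As \<open>card R \<le> 1\<close>, the
  strict bound \<open>card B + card C < length S\<close> suffices.\<close>

lemma card_sym_diff_MAW_le:
  assumes d: "length S \<ge> 3"
  shows "card (sym_diff (MAW S) (MAW (S @ [\<zero>]))) \<le> length S"
proof -
  obtain t where t: "shortest_new_suffix S t" using shortest_new_suffix_exists by blast
  define R where "R = MAW S - MAW (S @ [\<zero>])"
  define A where "A = MAW (S @ [\<zero>]) - MAW S"
  define B where "B = {w \<in> A. \<exists>b. w = t @ [b] \<and> sublist (tl t @ [b]) (S @ [\<zero>])}"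
  define C where "C = {w \<in> A. \<exists>a u. w = a # u @ [\<zero>] \<and> sublist (a # u) S \<and>
                      \<not> sublist (u @ [\<zero>]) S \<and> suffix u S \<and> \<not> suffix (a # u) S}"
  have A: "A = B \<union> C"
    using MAW_added_cases[OF _ t] unfolding A_def B_def C_def by blast
  have R: "card R \<le> 1"
    using MAW_removed_subset[OF t] card_mono[of "{t}" R] unfolding R_def by simp
  have Bsub: "B \<subseteq> {t @ [\<zero>], t @ [\<one>]}"
  proof
    fix w assume "w \<in> B"
    then obtain b where "w = t @ [b]" by (auto simp: B_def)
    then show "w \<in> {t @ [\<zero>], t @ [\<one>]}" by (cases b) auto
  qed
  have B: "card B \<le> 2"
    using card_mono[OF _ Bsub] card_insert_le_m1[of 2 "{t @ [\<one>]}" "t @ [\<zero>]"] by simp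
  \<comment> \<open>This number is the length of the new suffix \<open>u @ [\<zero>]\<close>, and
    also that of \<open>a # u\<close>, which occurs in \<open>S\<close> but not as a suffix.\<close>
  have range: "length w - 1 \<in> {length t..<length S}" if "w \<in> C" for w
  proof -
    obtain a u where w: "w = a # u @ [\<zero>]" "sublist (a # u) S" "\<not> sublist (u @ [\<zero>]) S"
      "suffix u S" "\<not> suffix (a # u) S" using \<open>w \<in> C\<close> by (auto simp: C_def)
    have "length t \<le> length (u @ [\<zero>])"
      using t w(3,4) by (intro shortest_new_suffix_le) auto
    then show ?thesis using nonsuffix_length_less[OF w(2,5)] w(1) by simp
  qed
  have inj: "inj_on (\<lambda>w. length w - 1) C"
  proof (rule inj_onI)
    fix v w assume v: "v \<in> C" and w: "w \<in> C" and l: "length v - 1 = length w - 1"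
    obtain a u where v': "v = a # u @ [\<zero>]" "sublist (a # u) S"
      "suffix u S" "\<not> suffix (a # u) S" using v by (auto simp: C_def)
    obtain b x where w': "w = b # x @ [\<zero>]"
      "suffix x S" "\<not> suffix (b # x) S" using w by (auto simp: C_def)
    have "a = b \<and> u = x"
      using v' w' l sublist_length_le[OF v'(2)] by (intro left_special_extension_unique[of u S x]) auto
    then show "v = w" using v' w' by simp
  qed
  have C: "card C \<le> card K" if "finite K" "\<And>w. w \<in> C \<Longrightarrow> length w - 1 \<in> K" for K
    using card_inj_on_le[OF inj _ that(1)] that(2) by blast
  have "t \<noteq> []" using t by (auto simp: shortest_new_suffix_def)
  then have "length t = 1 \<or> length t = 2 \<or> length t \<ge> 3" unfolding length_greater_0_conv[symmetric] by linarith
  then have "card B + card C < length S"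
  proof (elim disjE)
    \<comment> \<open>The subtraction below truncates when \<open>t\<close> is all of
      \<open>S @ [\<zero>]\<close>; then \<open>2 < length S\<close> closes the case.\<close>
    assume "length t \<ge> 3"
    moreover have "card C \<le> length S - length t"
      using C[of "{length t..<length S}"] range by simp
    ultimately show ?thesis using B d by linarith
  next
    assume "length t = 1"
    then have "t = [\<zero>]" using t by (auto simp: length_Suc_conv shortest_new_suffix_def)
    then have no0: "\<zero> \<notin> set S" using t by (auto simp: shortest_new_suffix_def sublist_def in_set_conv_decomp)
    have "S = replicate (length S) \<one>"
      using no0 by (rule no_Zero_imp_replicate_One)
    have "C = {}"
    proof (rule ccontr)
      assume "C \<noteq> {}"
      then obtain a u where w: "sublist (a # u) S" "\<not> suffix (a # u) S" by (auto simp: C_def)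
      then have "set (a # u) \<subseteq> set S" by (blast dest: set_mono_sublist)
      then have "a # u = replicate (length (a # u)) \<one>"
        using no0 by (intro no_Zero_imp_replicate_One) blast
      moreover have "suffix (replicate (length (a # u)) \<one>) (replicate (length S) \<one>)"
        using sublist_length_le[OF w(1)]
        by (metis suffix_def le_add_diff_inverse2 replicate_add)
      ultimately show False using w(2) \<open>S = _\<close> by metis
    qed
    then show ?thesis using B d by simp
  next
    assume t2: "length t = 2"
    show ?thesis
    proof (cases "\<exists>w\<in>C. length w = length S")
      case False
      \<comment> \<open>Only \<open>length S - 3\<close> lengths remain, which leaves room for two
        words in \<open>B\<close>.\<close>
      have "length w - 1 \<in> {2..<length S - 1}" if "w \<in> C" for w
      proof -
        have "length w \<noteq> length S" using False that by blast
        then show ?thesis using range[OF that] t2 by auto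
      qed
      then have "card C \<le> card {2..<length S - 1}" by (intro C) auto
      then show ?thesis using B d by simp
    next
      case True
      then obtain a u where w: "length (a # u @ [\<zero>]) = length S" "sublist (a # u) S"
        "suffix u S" "\<not> suffix (a # u) S" by (auto simp: C_def)
      obtain c where S: "S = a # replicate (length u + 1) c" "a \<noteq> c"
        using long_left_special_suffix[OF w(2-4)] w(1) by auto
      obtain n where n: "length u = Suc n" using d w(1) by (cases u) auto
      have S': "S = a # c # c # replicate n c" using S n by simp
      have "S = a # replicate (Suc n) c @ [c]" using S n by (simp add: replicate_append_same)
      then have "suffix [c, \<zero>] (S @ [\<zero>])" by (simp add: suffix_def)
      then have tc: "t = [c, \<zero>]"
        using t t2 by (intro suffix_same_length_eq[of _ "S @ [\<zero>]"]) (auto simp: shortest_new_suffix_def)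
      \<comment> \<open>Otherwise \<open>t\<close> would already occur in \<open>S\<close>, as the
        block \<open>c # c\<close> after the first letter.\<close>
      have "c = \<one>"
      proof (rule ccontr)
        assume "c \<noteq> \<one>"
        then have "c = \<zero>" by (cases c) auto
        then have "sublist t S" by (simp add: tc S' sublist_Cons_right)
        then show False using t by (simp add: shortest_new_suffix_def)
      qed
      then have a: "a = \<zero>" using S(2) by (cases a) auto
      \<comment> \<open>Membership of \<open>t @ [\<zero>]\<close> in \<open>B\<close> would require
        this occurrence. Losing that word makes up for the additional length in
        \<open>C\<close>.\<close>
      have "\<not> sublist [\<zero>, \<zero>] (S @ [\<zero>])"
      proof -
        have "\<not> sublist [\<zero>, \<zero>] (replicate m \<one> @ [\<zero>])" for m
          by (induction m) (auto simp: sublist_Cons_right)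
        from this[of "Suc (Suc n)"] show ?thesis by (simp add: S' a \<open>c = \<one>\<close> sublist_Cons_right)
      qed
      then have "B \<subseteq> {t @ [\<one>]}"
        using Bsub by (auto simp: B_def tc)
      then have "card B \<le> 1" using card_mono[of "{t @ [\<one>]}" B] by simp
      moreover have "card C \<le> length S - 2"
        using C[of "{length t..<length S}"] range t2 by simp
      ultimately show ?thesis using d by linarith
    qed
  qed
  moreover have "card (R \<union> A) \<le> card R + (card B + card C)"
    using card_Un_le[of R A] card_Un_le[of B C] A by simp
  ultimately show ?thesis using R unfolding R_def A_def by simp
qed

section \<open>Words attaining the bound\<close>

text \<open>The word \<open>[\<one>, \<zero>]\<close> leaves;
  \<open>[\<one>, \<zero>, \<one>]\<close> and the \<open>n + 1\<close> words of \<open>W\<close>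
  enter. The exponent in \<open>W\<close> stops at \<open>n + 1\<close> because \<open>n + 2\<close>
  would give the extended word itself, which is not absent.\<close>

lemma card_sym_diff_MAW_ge:
  "n + 3 \<le> card (sym_diff (MAW (\<zero> # replicate (n + 2) \<one>)) (MAW ((\<zero> # replicate (n + 2) \<one>) @ [\<zero>])))"
proof -
  define S where "S = \<zero> # replicate (n + 2) \<one>"
  define W where "W = (\<lambda>k. \<zero> # replicate k \<one> @ [\<zero>]) ` {1..n+1}"
  let ?D = "sym_diff (MAW S) (MAW (S @ [\<zero>]))"
  have S2: "S = (\<zero> # replicate (n + 1) \<one>) @ [\<one>]" by (simp add: S_def replicate_append_same)
  have no10: "\<not> sublist (replicate k \<one> @ [\<zero>]) S" if "k \<ge> 1" for k
  proof -
    have "\<not> prefix (replicate k \<one> @ [\<zero>]) S" using that by (cases k) (auto simp: S_def)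
    moreover have "\<not> sublist (replicate k \<one> @ [\<zero>]) (replicate (n + 2) \<one>)"
      using set_mono_sublist by fastforce
    ultimately show ?thesis by (simp add: S_def sublist_Cons_right del: replicate_Suc)
  qed
  have "[\<one>, \<zero>] \<in> ?D"
  proof -
    have "minimal_absent_word S (\<one> # [] @ [\<zero>])"
      using no10[of 1] unfolding minimal_absent_word_Cons_snoc_iff
      by (auto simp: S_def sublist_Cons_right)
    moreover have "sublist [\<one>, \<zero>] (S @ [\<zero>])"
      by (simp add: S2 sublist_append_single_iff suffix_def)
    ultimately show ?thesis by (auto simp: MAW_def minimal_absent_word_def)
  qed
  moreover have "[\<one>, \<zero>, \<one>] \<in> ?D"
  proof -
    have "\<not> sublist [\<one>, \<zero>] S" using no10[of 1] by simp
    moreover have "sublist [\<one>, \<zero>] [\<one>, \<zero>, \<one>]" by (simp add: sublist_Cons_right)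
    ultimately have "\<not> sublist [\<one>, \<zero>, \<one>] S" using sublist_order.order.trans by blast
    moreover have "\<not> suffix [\<one>, \<zero>, \<one>] (S @ [\<zero>])"
      using snoc_suffix_snoc[of "[\<one>, \<zero>]" \<one> S \<zero>] by simp
    moreover have "sublist [\<one>, \<zero>] (S @ [\<zero>])"
      by (simp add: S2 sublist_append_single_iff suffix_def)
    moreover have "sublist [\<zero>, \<one>] (S @ [\<zero>])" by (simp add: S_def sublist_Cons_right)
    ultimately have "minimal_absent_word (S @ [\<zero>]) (\<one> # [\<zero>] @ [\<one>])"
      and "\<not> minimal_absent_word S (\<one> # [\<zero>] @ [\<one>])"
      unfolding minimal_absent_word_Cons_snoc_iff
      using \<open>\<not> sublist [\<one>, \<zero>] S\<close> by (simp_all add: sublist_append_single_iff)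
    then show ?thesis by (simp add: MAW_def)
  qed
  \<comment> \<open>Deleting the last letter of \<open>w\<close> gives a prefix of \<open>S\<close>,
    deleting the first a suffix of \<open>S @ [\<zero>]\<close> that is absent from
    \<open>S\<close>; so \<open>w\<close> is minimal only after appending.\<close>
  moreover have "W \<subseteq> ?D"
  proof
    fix w assume "w \<in> W"
    then obtain k where k: "1 \<le> k" "k \<le> n + 1" and w: "w = \<zero> # replicate k \<one> @ [\<zero>]"
      by (auto simp: W_def)
    have tl: "\<not> sublist (replicate k \<one> @ [\<zero>]) S" using no10 k by simp
    have "replicate (n + 2) \<one> = replicate k \<one> @ replicate (n + 2 - k) \<one>"
      using k by (simp flip: replicate_add)
    then have pre: "sublist (\<zero> # replicate k \<one>) S"
      unfolding S_def by (metis append_Cons sublist_append_rightI)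
    have "replicate (n + 2) \<one> = replicate (n + 2 - k) \<one> @ replicate k \<one>"
      using k by (simp flip: replicate_add)
    then have suf: "suffix (replicate k \<one>) S" unfolding S_def
      by (metis append_Cons suffix_def)
    have "\<not> suffix (\<zero> # replicate k \<one>) S"
    proof
      assume "suffix (\<zero> # replicate k \<one>) S"
      moreover have "(\<zero> # replicate k \<one>) \<noteq> S" using k by (auto simp: S_def dest: arg_cong[where f = length])
      ultimately have "suffix (\<zero> # replicate k \<one>) (replicate (n + 2) \<one>)"
        by (simp add: S_def suffix_Cons)
      then show False using set_mono_suffix by fastforce
    qed
    then have "\<not> suffix (\<zero> # replicate k \<one> @ [\<zero>]) (S @ [\<zero>])"
      using snoc_suffix_snoc[of "\<zero> # replicate k \<one>" \<zero> S \<zero>] by simp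
    moreover have "\<not> sublist (\<zero> # replicate k \<one> @ [\<zero>]) S"
      using tl sublist_order.order.trans[of "replicate k \<one> @ [\<zero>]" "\<zero> # replicate k \<one> @ [\<zero>]" S]
      by (auto simp: sublist_Cons_right)
    ultimately have "minimal_absent_word (S @ [\<zero>]) w" "\<not> minimal_absent_word S w"
      using tl pre suf unfolding w minimal_absent_word_Cons_snoc_iff
      by (simp_all add: sublist_append_single_iff)
    then show "w \<in> ?D" by (simp add: MAW_def)
  qed
  ultimately have "insert [\<one>, \<zero>] (insert [\<one>, \<zero>, \<one>] W) \<subseteq> ?D" by blast
  moreover have "card (insert [\<one>, \<zero>] (insert [\<one>, \<zero>, \<one>] W)) = n + 3"
  proof -
    have "inj_on (\<lambda>k. \<zero> # replicate k \<one> @ [\<zero>]) {1..n+1}"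
      by (rule inj_onI) (auto dest: arg_cong[where f = length])
    then have "card W = n + 1" by (simp only: W_def card_image) simp
    moreover have "finite W" "[\<one>, \<zero>] \<notin> W" "[\<one>, \<zero>, \<one>] \<notin> W" by (auto simp: W_def)
    ultimately show ?thesis by simp
  qed
  ultimately show ?thesis
    using card_mono[of ?D] finite_MAW unfolding S_def by (metis finite_Diff finite_UnI)
qed

theorem theorem4:
  shows "(\<forall>d\<ge>3. \<forall>S. length S = d \<longrightarrow>
            card (sym_diff (MAW S) (MAW (S @ [\<zero>]))) \<le> d) \<and>
         (\<forall>d\<ge>3. \<exists>S. length S = d \<and>
            card (sym_diff (MAW S) (MAW (S @ [\<zero>]))) = d)"
proof (intro conjI allI impI)
  fix d :: nat and S :: "bin list"
  assume "3 \<le> d" "length S = d"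
  then show "card (sym_diff (MAW S) (MAW (S @ [\<zero>]))) \<le> d"
    using card_sym_diff_MAW_le by blast
next
  fix d :: nat
  assume "3 \<le> d"
  then obtain n where n: "d = n + 3" by (metis add.commute le_Suc_ex)
  let ?S = "\<zero> # replicate (n + 2) \<one>"
  have "length ?S = d" using n by simp
  moreover have "card (sym_diff (MAW ?S) (MAW (?S @ [\<zero>]))) = d"
    using card_sym_diff_MAW_le[of ?S] card_sym_diff_MAW_ge[of n] n by simp
  ultimately show "\<exists>S. length S = d \<and> card (sym_diff (MAW S) (MAW (S @ [\<zero>]))) = d"
    by blast
qed

end
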